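(* Let $X$ and $Y$ be two finite nonempty sets of sizes $n$ and $m$, respectively, and let $q\geq 1$ be an integer. Then $$\frac{1}{m^n}\sum_{f\colon X\to Y}\deg(f,q)=\frac{1}{m^{q-1}}\sum_{k=1}^{q}{q \brace k}\left(\sum_{j=1}^{k}(-1)^{k-j}{k \brack j}n^{j-1}\right)m^{q-k},$$ where the sum on the left-hand side is over all functions $f\colon X\to Y$.
   Context: For a function $f\colon X\to Y$ between two finite nonempty sets and an integer $q\geq 1$, define $\deg(f, q)=\frac{1}{|X|}\sum_{y\in Y}|f^{-1}(y)|^q$, where $f^{-1}(y)=\{x\in X : f(x)=y\}$. The symbol ${n\brace k}$ denotes the Stirling number of the second kind (the number of partitions of an $n$-element set into $k$ nonempty blocks), and ${n\brack k}$ denotes the (unsigned) Stirling number of the first kind (the number of permutations of $n$ elements with exactly $k$ cycles). *)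

theory Defs
  imports Complex_Main "HOL-Library.FuncSet" "HOL-Combinatorics.Stirling"
begin

text \<open>
  A function from \<open>X\<close> to \<open>Y\<close> is represented by its unique extension in \<open>X \<rightarrow>\<^sub>E Y\<close>, which is
  \<open>undefined\<close> outside \<open>X\<close>. The fibre is therefore restricted to \<open>X\<close>: over \<open>y\<close> it is \<open>{x \<in> X. f x = y}\<close>.
\<close>

definition deg :: "'a set \<Rightarrow> 'b set \<Rightarrow> ('a \<Rightarrow> 'b) \<Rightarrow> nat \<Rightarrow> real"
  where "deg X Y f q = 1 / real (card X) * (\<Sum>y\<in>Y. real (card {x \<in> X. f x = y}) ^ q)"

text \<open>
  The library writes \<open>Stirling q k\<close> (capital S) for the Stirling numbers of the second kind and
  \<open>stirling k j\<close> (lower case) for the unsigned Stirling numbers of the first kind.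
\<close>

end

theory Submission
  imports Defs
begin

text \<open>
  Averaging a power of a fibre size is awkward, but averaging a binomial coefficient is double
  counting: \<open>|f\<^sup>-\<^sup>1(y)| choose k\<close> counts the \<open>k\<close>-subsets of \<open>X\<close> on which \<open>f\<close> is constantly
  \<open>y\<close>, and a given \<open>k\<close>-subset is of this kind for exactly \<open>m ^ (n - k)\<close> functions
  (\<open>sum_choose_card_fibre\<close>).

  Stirling numbers of the second kind expand a \<open>q\<close>-th power in the falling factorials
  \<open>k! (x choose k)\<close> (\<open>power_eq_sum_Stirling\<close>), which reduces the left-hand side to these
  binomial averages. What results contains the falling factorial of \<open>n\<close>, and signed Stirling
  numbers of the first kind turn it back into powers of \<open>n\<close> (\<open>fact_choose_eq_sum_stirling\<close>).
  For \<open>k \<ge> 1\<close> this polynomial in \<open>n\<close> has no constant term, so the factor \<open>1 / n\<close> in the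
  degree lowers each exponent \<open>j\<close> to \<open>j - 1\<close>. The sum over \<open>y\<close> contributes a factor \<open>m\<close>.
\<close>

text \<open>
  The falling factorials \<open>F\<^sub>k = k! (x choose k)\<close> satisfy \<open>x F\<^sub>k = k F\<^sub>k + F\<^sub>k\<^sub>+\<^sub>1\<close>, so
  multiplication by \<open>x\<close> acts on their coefficients by the recurrence of the Stirling numbers.
\<close>

lemma power_eq_sum_Stirling:
  fixes x q :: nat
  shows "x ^ q = (\<Sum>k\<le>q. Stirling q k * (fact k * (x choose k)))"
proof (induction q)
  case 0
  then show ?case by simp
next
  case (Suc q)
  let ?F = "\<lambda>k. fact k * (x choose k) :: nat"
  have step: "x * ?F k = k * ?F k + ?F (Suc k)" for k
  proof (cases "k \<le> x")
    case True
    have "Suc k * (x choose Suc k) = (x - k) * (x choose k)"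
      by (metis binomial_absorb_comp binomial_absorption)
    then have "fact k * (Suc k * (x choose Suc k)) = fact k * ((x - k) * (x choose k))"
      by (simp only:)
    then have "?F (Suc k) = (x - k) * ?F k"
      by (simp only: fact_Suc of_nat_id mult_ac)
    with True show ?thesis
      by (simp flip: add_mult_distrib)
  qed (simp add: binomial_eq_0)
  have "x ^ Suc q = (\<Sum>k\<le>q. Stirling q k * (x * ?F k))"
    by (simp add: Suc.IH sum_distrib_left mult.left_commute)
  also have "\<dots> = (\<Sum>k\<le>q. k * Stirling q k * ?F k) + (\<Sum>k\<le>q. Stirling q k * ?F (Suc k))"
    by (simp only: step sum.distrib[symmetric]) (simp add: algebra_simps)
  also have "(\<Sum>k\<le>q. k * Stirling q k * ?F k) = (\<Sum>k\<le>Suc q. k * Stirling q k * ?F k)"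
    by simp
  also have "\<dots> = (\<Sum>k\<le>q. Suc k * Stirling q (Suc k) * ?F (Suc k))"
    by (subst sum.atMost_Suc_shift) simp
  also have "\<dots> + (\<Sum>k\<le>q. Stirling q k * ?F (Suc k))
      = (\<Sum>k\<le>q. Stirling (Suc q) (Suc k) * ?F (Suc k))"
    by (simp only: Stirling.simps sum.distrib[symmetric] add_mult_distrib)
  also have "\<dots> = (\<Sum>k\<le>Suc q. Stirling (Suc q) k * ?F k)"
    by (subst sum.atMost_Suc_shift) simp
  finally show ?case .
qed

text \<open>
  The unsigned numbers expand the rising factorial; evaluating it at \<open>- n\<close> gives the falling
  factorial of \<open>n\<close> up to the sign \<open>(- 1) ^ k\<close>.
\<close>

lemma fact_choose_eq_sum_stirling:
  fixes n k :: nat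
  shows "fact k * real (n choose k) = (\<Sum>j\<le>k. (-1) ^ (k - j) * real (stirling k j) * real n ^ j)"
proof -
  have sign: "(-1) ^ k * (- real n) ^ j = (-1) ^ (k - j) * real n ^ j" if "j \<le> k" for j
  proof -
    have "(-1 :: real) ^ k * (-1) ^ j = (-1) ^ (k - j)"
      using that by (simp add: power_diff power_minus1_even minus_one_power_iff)
    then show ?thesis
      by (subst power_minus) (simp flip: mult.assoc)
  qed
  have "fact k * real (n choose k) = (-1) ^ k * pochhammer (- real n) k"
    by (simp add: binomial_gbinomial gbinomial_pochhammer)
  also have "\<dots> = (\<Sum>j\<le>k. real (stirling k j) * ((-1) ^ k * (- real n) ^ j))"
    by (simp add: sum_distrib_left mult.left_commute flip: stirling_pochhammer)
  also have "\<dots> = (\<Sum>j\<le>k. (-1) ^ (k - j) * real (stirling k j) * real n ^ j)"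
    by (rule sum.cong) (simp_all add: sign)
  finally show ?thesis .
qed

lemma card_PiE_const_on:
  assumes "finite X" and "K \<subseteq> X" and "y \<in> Y"
  shows "card {f \<in> X \<rightarrow>\<^sub>E Y. \<forall>x\<in>K. f x = y} = card Y ^ (card X - card K)"
proof -
  have "{f \<in> X \<rightarrow>\<^sub>E Y. \<forall>x\<in>K. f x = y} = (\<Pi>\<^sub>E x\<in>X. if x \<in> K then {y} else Y)"
    using assms by (auto simp: PiE_iff extensional_def split: if_splits)
  then have "card {f \<in> X \<rightarrow>\<^sub>E Y. \<forall>x\<in>K. f x = y} = (\<Prod>x\<in>X. if x \<in> K then 1 else card Y)"
    using assms(1) by (simp add: card_PiE if_distrib cong: if_cong)
  also have "\<dots> = (\<Prod>x\<in>X - K. card Y)"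
    using assms(1) by (intro prod.mono_neutral_cong_right) auto
  also have "\<dots> = card Y ^ (card X - card K)"
    using assms by (simp add: card_Diff_subset finite_subset)
  finally show ?thesis .
qed

text \<open>
  Both sides count the pairs of a function \<open>f\<close> and a \<open>k\<close>-subset \<open>K\<close> of the fibre of \<open>f\<close>
  over \<open>y\<close>; the right-hand side chooses \<open>K\<close> first.
\<close>

lemma sum_choose_card_fibre:
  assumes "finite X" and "finite Y" and "y \<in> Y"
  shows "(\<Sum>f\<in>X \<rightarrow>\<^sub>E Y. card {x \<in> X. f x = y} choose k)
    = (card X choose k) * card Y ^ (card X - k)"
proof -
  let ?S = "{K. K \<subseteq> X \<and> card K = k}"
  let ?F = "X \<rightarrow>\<^sub>E Y"
  have finS: "finite ?S" and finF: "finite ?F"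
    using assms by (auto intro: finite_PiE)
  have "(\<Sum>f\<in>?F. card {x \<in> X. f x = y} choose k) = (\<Sum>f\<in>?F. card {K \<in> ?S. \<forall>x\<in>K. f x = y})"
  proof (rule sum.cong)
    fix f
    have "card {x \<in> X. f x = y} choose k = card {K. K \<subseteq> {x \<in> X. f x = y} \<and> card K = k}"
      using assms(1) by (simp add: n_subsets)
    also have "{K. K \<subseteq> {x \<in> X. f x = y} \<and> card K = k} = {K \<in> ?S. \<forall>x\<in>K. f x = y}"
      by auto
    finally show "card {x \<in> X. f x = y} choose k = card {K \<in> ?S. \<forall>x\<in>K. f x = y}" .
  qed simp
  also have "\<dots> = (\<Sum>K\<in>?S. card {f \<in> ?F. \<forall>x\<in>K. f x = y})"
    by (rule sum_multicount_gen[OF finF finS]) simp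
  also have "\<dots> = (\<Sum>K\<in>?S. card Y ^ (card X - k))"
    using assms by (intro sum.cong) (auto simp: card_PiE_const_on)
  also have "\<dots> = (card X choose k) * card Y ^ (card X - k)"
    using assms(1) by (simp add: n_subsets)
  finally show ?thesis .
qed

lemma sum_power_card_fibre:
  assumes "finite X" and "finite Y" and "y \<in> Y"
  shows "(\<Sum>f\<in>X \<rightarrow>\<^sub>E Y. card {x \<in> X. f x = y} ^ q)
    = (\<Sum>k\<le>q. Stirling q k * (fact k * (card X choose k)) * card Y ^ (card X - k))"
proof -
  have "(\<Sum>f\<in>X \<rightarrow>\<^sub>E Y. card {x \<in> X. f x = y} ^ q)
      = (\<Sum>k\<le>q. \<Sum>f\<in>X \<rightarrow>\<^sub>E Y. Stirling q k * (fact k * (card {x \<in> X. f x = y} choose k)))"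
    by (subst power_eq_sum_Stirling) (rule sum.swap)
  also have "\<dots> = (\<Sum>k\<le>q. Stirling q k * (fact k *
      (\<Sum>f\<in>X \<rightarrow>\<^sub>E Y. card {x \<in> X. f x = y} choose k)))"
    by (simp only: sum_distrib_left)
  also have "\<dots> = (\<Sum>k\<le>q. Stirling q k * (fact k * (card X choose k)) * card Y ^ (card X - k))"
    using assms by (simp add: sum_choose_card_fibre mult.assoc)
  finally show ?thesis .
qed

theorem theorem2p5:
  fixes X :: "'a set" and Y :: "'b set" and n m q :: nat
  assumes "finite X" and "X \<noteq> {}" and "card X = n"
    and "finite Y" and "Y \<noteq> {}" and "card Y = m"
    and "q \<ge> 1"
  shows "1 / real m ^ n * (\<Sum>f\<in>X \<rightarrow>\<^sub>E Y. deg X Y f q)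
    = 1 / real m ^ (q - 1) *
      (\<Sum>k=1..q. real (Stirling q k) *
        (\<Sum>j=1..k. (-1) ^ (k - j) * real (stirling k j) * real n ^ (j - 1)) *
        real m ^ (q - k))"
proof -
  have n: "n > 0" and m: "m > 0"
    using assms by (auto simp: card_gt_0_iff)
  let ?P = "\<lambda>k. \<Sum>j=1..k. (-1) ^ (k - j) * real (stirling k j) * real n ^ (j - 1)"
  have falling: "fact k * real (n choose k) = real n * ?P k" if "k \<ge> 1" for k
  proof -
    have "fact k * real (n choose k)
        = (\<Sum>j=1..k. (-1) ^ (k - j) * real (stirling k j) * real n ^ j)"
      unfolding fact_choose_eq_sum_stirling using that
      by (intro sum.mono_neutral_right) (auto simp: not_less_eq_eq)
    also have "\<dots> = (\<Sum>j=1..k. real n * ((-1) ^ (k - j) * real (stirling k j) * real n ^ (j - 1)))"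
    proof (rule sum.cong)
      fix j assume "j \<in> {1..k}"
      then have "real n ^ j = real n * real n ^ (j - 1)"
        by (simp flip: power_Suc)
      then show "(-1) ^ (k - j) * real (stirling k j) * real n ^ j
          = real n * ((-1) ^ (k - j) * real (stirling k j) * real n ^ (j - 1))"
        by simp
    qed simp
    finally show ?thesis
      by (simp add: sum_distrib_left)
  qed
  have "(\<Sum>f\<in>X \<rightarrow>\<^sub>E Y. deg X Y f q)
      = 1 / real n * (\<Sum>y\<in>Y. real (\<Sum>f\<in>X \<rightarrow>\<^sub>E Y. card {x \<in> X. f x = y} ^ q))"
    unfolding deg_def assms(3) by (simp add: sum.swap[of _ Y] flip: sum_distrib_left sum_divide_distrib)
  also have "\<dots> = 1 / real n * (real m *
      (\<Sum>k\<le>q. real (Stirling q k) * (fact k * real (n choose k)) * real m ^ (n - k)))"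
    using assms by (simp add: sum_power_card_fibre del: of_nat_sum) simp
  also have "(\<Sum>k\<le>q. real (Stirling q k) * (fact k * real (n choose k)) * real m ^ (n - k))
      = (\<Sum>k=1..q. real (Stirling q k) * (fact k * real (n choose k)) * real m ^ (n - k))"
  proof (rule sum.mono_neutral_right)
    have "{..q} - {1..q} = {0}"
      by auto
    moreover have "Stirling q 0 = 0"
      using assms(7) by (cases q) auto
    ultimately show "\<forall>k\<in>{..q} - {1..q}.
        real (Stirling q k) * (fact k * real (n choose k)) * real m ^ (n - k) = 0"
      by simp
  qed auto
  finally have sum_deg: "1 / real m ^ n * (\<Sum>f\<in>X \<rightarrow>\<^sub>E Y. deg X Y f q)
      = (\<Sum>k=1..q. 1 / real m ^ n * (1 / real n * (real m *
          (real (Stirling q k) * (fact k * real (n choose k)) * real m ^ (n - k)))))"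
    by (simp only: sum_distrib_left)
  have "1 / real m ^ n * (1 / real n * (real m *
        (real (Stirling q k) * (fact k * real (n choose k)) * real m ^ (n - k))))
      = 1 / real m ^ (q - 1) * (real (Stirling q k) * ?P k * real m ^ (q - k))"
    if k: "k \<in> {1..q}" for k
  proof (cases "k \<le> n")
    case True
    have "real m ^ n = real m ^ k * real m ^ (n - k)"
      using True by (simp flip: power_add)
    moreover have "real m * real m ^ (q - 1) = real m ^ k * real m ^ (q - k)"
      using k assms(7) by (simp flip: power_add power_Suc)
    ultimately have "1 / real m ^ n * (real m * real m ^ (n - k)) = 1 / real m ^ (q - 1) * real m ^ (q - k)"
      using m by (simp add: field_simps)
    moreover have "1 / real n * (fact k * real (n choose k)) = ?P k"
      using k n by (simp add: falling)
    moreover have "1 / real m ^ n * (1 / real n * (real m *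
          (real (Stirling q k) * (fact k * real (n choose k)) * real m ^ (n - k))))
        = real (Stirling q k) * (1 / real n * (fact k * real (n choose k))) *
          (1 / real m ^ n * (real m * real m ^ (n - k)))"
      by (simp only: mult_ac)
    ultimately show ?thesis
      by (simp only: mult_ac)
  next
    \<comment> \<open>The truncated exponent \<open>n - k\<close> is harmless here, as both sides vanish.\<close>
    case False
    then have "?P k = 0"
      using falling[of k] k n by (simp add: binomial_eq_0)
    with False show ?thesis
      by (simp add: binomial_eq_0)
  qed
  then show ?thesis
    unfolding sum_deg sum_distrib_left[of "1 / real m ^ (q - 1)"] by (rule sum.cong[OF refl])
qed

end
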